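(* Let $\mathcal{H}=\{A^o,B^o,A_2,B_2,AB\}$ be a set of five distinct elements, and let $+:\mathcal{H}\times\mathcal{H}\to p^*(\mathcal{H})$ be the hyperoperation given by the following table (the entry in row $x$ and column $y$ is the set $x+y$, listed by its elements): $$ \begin{array}{c|c|c|c|c|c} + & A^o & B^o & A_2 & B_2 & AB\\ \hline A^o & A^o,A_2 & A^o,B^o,AB & A^o,A_2 & A^o,B_2,B^o,AB & A^o,AB,A_2,B^o\\ \hline B^o & A^o,B^o,AB & B^o,B_2 & A^o,B^o,AB,A_2 & B^o,B_2 & A^o,B^o,AB,B_2\\ \hline A_2 & A^o,A_2 & A^o,B^o,AB,A_2 & A^o,A_2 & A^o,B^o,A_2,B_2,AB & A^o,B^o,A_2,AB\\ \hline B_2 & A^o,B^o,B_2,AB & B^o,B_2 & A^o,B^o,A_2,B_2,AB & B^o,B_2 & A^o,B^o,B_2,AB\\ \hline AB & A^o,AB,A_2,B^o & A^o,B^o,AB,B_2 & A^o,B^o,A_2,AB & A^o,B^o,B_2,AB & A^o,B^o,A_2,B_2,AB \end{array} $$ Then $(\mathcal{H},+)$ is an $H_v$-group.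
   Context: For a non-empty set $H$, $p^*(H)$ denotes the set of all non-empty subsets of $H$. A hyperoperation on $H$ is a function $\cdot:H\times H\to p^*(H)$; the pair $(H,\cdot)$ is called a hypergroupoid. For non-empty subsets $A,B\subseteq H$ and $x\in H$, set $A\cdot B=\bigcup_{a\in A,\,b\in B}a\cdot b$, $x\cdot B=\{x\}\cdot B$ and $A\cdot x=A\cdot\{x\}$. A hypergroupoid $(H,\cdot)$ is an $H_v$-group if for all $x,y,z\in H$: (1) $x\cdot(y\cdot z)\cap(x\cdot y)\cdot z\neq\emptyset$ (weak associativity), and (2) $x\cdot H=H\cdot x=H$. The symbols $A^o,B^o,A_2,B_2,AB$ are formal names of the five elements (they come from chemical species in a chain reaction $A_2+B_2\leftrightarrow 2AB$); $AB$ is a single element, not a product. *)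

theory Defs
  imports Main
begin

definition hypergroupoid :: "'a set \<Rightarrow> ('a \<Rightarrow> 'a \<Rightarrow> 'a set) \<Rightarrow> bool" where
  "hypergroupoid H f \<longleftrightarrow> H \<noteq> {} \<and> (\<forall>x\<in>H. \<forall>y\<in>H. f x y \<in> Pow H - {{}})"

definition set_hyperop :: "('a \<Rightarrow> 'a \<Rightarrow> 'a set) \<Rightarrow> 'a set \<Rightarrow> 'a set \<Rightarrow> 'a set" where
  "set_hyperop f A B = (\<Union>a\<in>A. \<Union>b\<in>B. f a b)"

definition Hv_group :: "'a set \<Rightarrow> ('a \<Rightarrow> 'a \<Rightarrow> 'a set) \<Rightarrow> bool" where
  "Hv_group H f \<longleftrightarrow>
     hypergroupoid H f \<and>
     (\<forall>x\<in>H. \<forall>y\<in>H. \<forall>z\<in>H.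
        set_hyperop f {x} (f y z) \<inter> set_hyperop f (f x y) {z} \<noteq> {}) \<and>
     (\<forall>x\<in>H. set_hyperop f {x} H = H \<and> set_hyperop f H {x} = H)"

text \<open>
  The chemical species of the chain reaction \<open>A\<^sub>2 + B\<^sub>2 \<leftrightarrow> 2AB\<close>;
  \<open>Ao\<close> and \<open>Bo\<close> stand for \<open>A\<^sup>o\<close> and \<open>B\<^sup>o\<close>.
\<close>

datatype species = Ao | Bo | A2 | B2 | AB

definition all_species :: "species set" where
  "all_species = {Ao, Bo, A2, B2, AB}"

fun species_add :: "species \<Rightarrow> species \<Rightarrow> species set" where
  "species_add Ao Ao = {Ao, A2}"
| "species_add Ao Bo = {Ao, Bo, AB}"
| "species_add Ao A2 = {Ao, A2}"
| "species_add Ao B2 = {Ao, B2, Bo, AB}"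
| "species_add Ao AB = {Ao, AB, A2, Bo}"
| "species_add Bo Ao = {Ao, Bo, AB}"
| "species_add Bo Bo = {Bo, B2}"
| "species_add Bo A2 = {Ao, Bo, AB, A2}"
| "species_add Bo B2 = {Bo, B2}"
| "species_add Bo AB = {Ao, Bo, AB, B2}"
| "species_add A2 Ao = {Ao, A2}"
| "species_add A2 Bo = {Ao, Bo, AB, A2}"
| "species_add A2 A2 = {Ao, A2}"
| "species_add A2 B2 = {Ao, Bo, A2, B2, AB}"
| "species_add A2 AB = {Ao, Bo, A2, AB}"
| "species_add B2 Ao = {Ao, Bo, B2, AB}"
| "species_add B2 Bo = {Bo, B2}"
| "species_add B2 A2 = {Ao, Bo, A2, B2, AB}"
| "species_add B2 B2 = {Bo, B2}"
| "species_add B2 AB = {Ao, Bo, B2, AB}"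
| "species_add AB Ao = {Ao, AB, A2, Bo}"
| "species_add AB Bo = {Ao, Bo, AB, B2}"
| "species_add AB A2 = {Ao, Bo, A2, AB}"
| "species_add AB B2 = {Ao, Bo, B2, AB}"
| "species_add AB AB = {Ao, Bo, A2, B2, AB}"

end

theory Submission
  imports Defs
begin

text \<open>
  Each entry of the table contains both of the elements that are composed: species that meet
  need not react. Any hyperoperation with this property already gives an \<open>H\<^sub>v\<close>-group
  (\<open>Hv_group_if_extensive\<close>), so the table need only be inspected for two-element inclusions,
  and no triple products have to be computed.
\<close>

text \<open>
  The middle factor \<open>y\<close> witnesses weak associativity: since \<open>y \<in> f y z\<close>, the product
  \<open>x \<cdot> (y \<cdot> z)\<close> contains all of \<open>f x y\<close>, hence \<open>y\<close>; symmetrically on the other side.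
\<close>

lemma Hv_group_if_extensive:
  assumes nonempty: "H \<noteq> {}"
    and closed: "\<And>x y. x \<in> H \<Longrightarrow> y \<in> H \<Longrightarrow> f x y \<subseteq> H"
    and extensive: "\<And>x y. x \<in> H \<Longrightarrow> y \<in> H \<Longrightarrow> {x, y} \<subseteq> f x y"
  shows "Hv_group H f"
  unfolding Hv_group_def
proof (intro conjI ballI)
  show "hypergroupoid H f"
    using nonempty closed extensive unfolding hypergroupoid_def by blast
next
  fix x y z assume "x \<in> H" "y \<in> H" "z \<in> H"
  then have "y \<in> f x y" "y \<in> f y z"
    using extensive by blast+
  then have "y \<in> set_hyperop f {x} (f y z) \<inter> set_hyperop f (f x y) {z}"
    unfolding set_hyperop_def by blast
  then show "set_hyperop f {x} (f y z) \<inter> set_hyperop f (f x y) {z} \<noteq> {}"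
    by blast
next
  fix x assume x: "x \<in> H"
  have "f x b \<subseteq> H" "f b x \<subseteq> H" "b \<in> f x b" "b \<in> f b x" if "b \<in> H" for b
    using closed[OF x that] closed[OF that x] extensive[OF x that] extensive[OF that x]
    by simp_all
  then show "set_hyperop f {x} H = H" "set_hyperop f H {x} = H"
    by (auto simp: set_hyperop_def)
qed

lemma all_species_eq_UNIV: "all_species = UNIV"
proof -
  have "x \<in> all_species" for x
    by (cases x) (simp_all add: all_species_def)
  then show ?thesis by auto
qed

lemma species_add_extensive: "{x, y} \<subseteq> species_add x y"
  by (cases x; cases y) simp_all

theorem mainTheorem1:
  shows "Hv_group all_species species_add"
  by (rule Hv_group_if_extensive) (simp_all only: all_species_eq_UNIV species_add_extensive
      UNIV_not_empty subset_UNIV not_False_eq_True)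

end
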